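(* Let $c>0$. For all $x\in[0,1)$ and $\beta>1$, $$L(x,\beta)=\Lambda^*_{c(1-x)}(\beta-1),$$ where $L(x,\beta)=(\beta-1)\left[\log\left(\frac{\beta-1}{c(1-x)}\right)-1\right]+c(1-x)$ and, for $\lambda>0$, $\Lambda^*_\lambda$ is the large deviation rate function for the average of independent Poisson random variables with parameter $\lambda$.
   Context: The large deviation rate function for the average of i.i.d. random variables is the one given by Cramér's theorem, i.e. the Legendre transform $\Lambda^*_\lambda(u)=\sup_{\theta\in\mathbb R}\{\theta u-\log\mathbb E[e^{\theta X}]\}$, where here $X$ is Poisson with parameter $\lambda$. *)

theory Defs
  imports "HOL-Probability.Probability"
begin

(* log E[exp (theta X)] as an extended real: the expectation is a nonnegative integral, so a divergent
   one gives \<infinity> (a Bochner integral would give 0). For a random variable it is never 0,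
   so the convention ln 0 = 0 plays no role. *)
definition log_mgf :: "'a measure \<Rightarrow> ('a \<Rightarrow> real) \<Rightarrow> real \<Rightarrow> ereal" where
  "log_mgf M X \<theta> =
     (let m = (\<integral>\<^sup>+ \<omega>. ennreal (exp (\<theta> * X \<omega>)) \<partial>M)
      in if m = \<infinity> then \<infinity> else ereal (ln (enn2real m)))"

(* The rate function that Cramer's theorem gives for averages of i.i.d. copies of X:
   the Legendre transform of log_mgf. *)
definition cramer_rate :: "'a measure \<Rightarrow> ('a \<Rightarrow> real) \<Rightarrow> real \<Rightarrow> ereal" where
  "cramer_rate M X u = (SUP \<theta>. ereal (\<theta> * u) - log_mgf M X \<theta>)"

(* poisson_pmf is only specified for positive parameters. *)
definition poisson_rate :: "real \<Rightarrow> real \<Rightarrow> ereal" where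
  "poisson_rate lam = cramer_rate (measure_pmf (poisson_pmf lam)) real"

definition L :: "real \<Rightarrow> real \<Rightarrow> real \<Rightarrow> real" where
  "L c x \<beta> = (\<beta> - 1) * (ln ((\<beta> - 1) / (c * (1 - x))) - 1) + c * (1 - x)"

end

theory Submission
  imports Defs
begin

text \<open>The exponential moments of a Poisson variable are all finite, with logarithm
  \<open>lam * (exp \<theta> - 1)\<close> (\<open>log_mgf_poisson_pmf\<close>). For
  \<open>u > 0\<close> the concave function \<open>\<theta> * u - lam * (exp \<theta> - 1)\<close>
  is largest where its derivative \<open>u - lam * exp \<theta>\<close> vanishes, and its value
  there is the closed form of \<open>poisson_rate_eq\<close>. Putting
  \<open>lam = c * (1 - x)\<close> and \<open>u = \<beta> - 1\<close> turns this form into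
  \<open>L\<close>.\<close>

lemma nn_integral_exp_poisson_pmf:
  fixes lam \<theta> :: real
  assumes "lam > 0"
  shows "(\<integral>\<^sup>+ k. ennreal (exp (\<theta> * real k)) \<partial>measure_pmf (poisson_pmf lam)) =
    ennreal (exp (lam * (exp \<theta> - 1)))"
proof -
  \<comment> \<open>The factor \<open>exp (\<theta> * real k)\<close> is absorbed into the power of
    \<open>lam\<close>, which leaves the exponential series at
    \<open>lam * exp \<theta>\<close>.\<close>
  have summand: "pmf (poisson_pmf lam) k * exp (\<theta> * real k) =
      exp (- lam) * ((lam * exp \<theta>) ^ k /\<^sub>R fact k)" for k
    using assms
    by (simp add: pmf_poisson power_mult_distrib exp_of_nat_mult [symmetric] divide_inverse mult_ac)
  have "(\<lambda>k. pmf (poisson_pmf lam) k * exp (\<theta> * real k)) sums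
      (exp (- lam) * exp (lam * exp \<theta>))"
    unfolding summand by (intro sums_mult exp_converges)
  moreover have "exp (- lam) * exp (lam * exp \<theta>) = exp (lam * (exp \<theta> - 1))"
    by (simp add: exp_add [symmetric] algebra_simps)
  ultimately have sums: "(\<lambda>k. pmf (poisson_pmf lam) k * exp (\<theta> * real k)) sums
      exp (lam * (exp \<theta> - 1))"
    by simp
  have "(\<integral>\<^sup>+ k. ennreal (exp (\<theta> * real k)) \<partial>measure_pmf (poisson_pmf lam)) =
      (\<integral>\<^sup>+ k. ennreal (pmf (poisson_pmf lam) k * exp (\<theta> * real k)) \<partial>count_space UNIV)"
    by (simp add: nn_integral_measure_pmf ennreal_mult)
  also have "\<dots> = (\<Sum>k. ennreal (pmf (poisson_pmf lam) k * exp (\<theta> * real k)))"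
    by (rule nn_integral_count_space_nat)
  \<comment> \<open>The terms are nonnegative, so the real sum carries over to
    \<open>ennreal\<close>.\<close>
  also have "\<dots> = ennreal (exp (lam * (exp \<theta> - 1)))"
    by (rule suminf_ennreal_eq [OF _ sums]) simp
  finally show ?thesis .
qed

text \<open>The moment is finite for every \<open>\<theta>\<close>, so the infinite branch of
  \<open>log_mgf\<close> never occurs and \<open>ln\<close> cancels \<open>exp\<close>.\<close>

lemma log_mgf_poisson_pmf:
  assumes "lam > 0"
  shows "log_mgf (measure_pmf (poisson_pmf lam)) real \<theta> = ereal (lam * (exp \<theta> - 1))"
  using assms by (simp add: log_mgf_def nn_integral_exp_poisson_pmf)

text \<open>The supremum is attained at \<open>\<theta> = ln (u / lam)\<close>; that it is an upper bound is
  \<open>ln t \<le> t - 1\<close> at \<open>t = lam * exp \<theta> / u\<close>.\<close>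

lemma poisson_rate_eq:
  fixes lam u :: real
  assumes "lam > 0" and "u > 0"
  shows "poisson_rate lam u = ereal (u * (ln (u / lam) - 1) + lam)"
proof -
  have "(SUP \<theta>. ereal (\<theta> * u - lam * (exp \<theta> - 1))) = ereal (u * (ln (u / lam) - 1) + lam)"
  proof (rule antisym)
    show "(SUP \<theta>. ereal (\<theta> * u - lam * (exp \<theta> - 1))) \<le> ereal (u * (ln (u / lam) - 1) + lam)"
    proof (rule SUP_least)
      fix \<theta> :: real
      have "ln (lam * exp \<theta> / u) \<le> lam * exp \<theta> / u - 1"
        using assms by (intro ln_le_minus_one) simp
      moreover have "ln (lam * exp \<theta> / u) = \<theta> - ln (u / lam)"
        using assms by (simp add: ln_div ln_mult)
      \<comment> \<open>Multiplying by \<open>u > 0\<close> clears the denominator; what remains is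
        a rearrangement of the bound.\<close>
      ultimately have "u * (\<theta> - ln (u / lam)) \<le> u * (lam * exp \<theta> / u - 1)"
        using assms by (intro mult_left_mono) auto
      then show "ereal (\<theta> * u - lam * (exp \<theta> - 1)) \<le> ereal (u * (ln (u / lam) - 1) + lam)"
        using assms by (simp add: algebra_simps)
    qed
    have "u * (ln (u / lam) - 1) + lam = ln (u / lam) * u - lam * (exp (ln (u / lam)) - 1)"
      using assms by (simp add: algebra_simps)
    then show "ereal (u * (ln (u / lam) - 1) + lam) \<le>
        (SUP \<theta>. ereal (\<theta> * u - lam * (exp \<theta> - 1)))"
      by (intro SUP_upper2 [where i = "ln (u / lam)"]) auto
  qed
  then show ?thesis
    using assms by (simp add: poisson_rate_def cramer_rate_def log_mgf_poisson_pmf)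
qed

theorem proposition2p3:
  fixes c x \<beta> :: real
  assumes "c > 0"
    and "0 \<le> x" and "x < 1"
    and "\<beta> > 1"
  shows "ereal (L c x \<beta>) = poisson_rate (c * (1 - x)) (\<beta> - 1)"
  using assms by (simp add: L_def poisson_rate_eq)

end
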